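(* Let $\mathcal M\subset\mathbb R^d$ be a smooth compact submanifold with reach $\tau$, let $\Omega$ be an arbitrary domain, and let $I_{\mathbb R^d}\colon C(\Omega,\mathbb R^d)\to C(\Omega,\mathbb R^d)$ be an arbitrary approximation operator. Let $f\in C(\Omega,\mathcal M)$ be a continuous $\mathcal M$-valued function such that for all $\mathbf x\in\Omega$ the value $I_{\mathbb R^d}f(\mathbf x)$ is contained in the reach of $\mathcal M$, i.e. $I_{\mathbb R^d}f(\mathbf x)\in U=\{\mathbf y\in\mathbb R^d:\min_{\mathbf m\in\mathcal M}\|\mathbf y-\mathbf m\|_2<\tau\}$. Then, with $I_{\mathcal M}f=P_{\mathcal M}\circ I_{\mathbb R^d}f$, for all $\mathbf x\in\Omega$ $$\|I_{\mathcal M}f(\mathbf x)-f(\mathbf x)\|_2\le2\,\|I_{\mathbb R^d}f(\mathbf x)-f(\mathbf x)\|_2.$$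
   Context: The reach $\tau>0$ of a smooth compact submanifold $\mathcal M\subset\mathbb R^d$ is the maximal constant such that $E(\mathbf m,\mathbf v)=\mathbf m+\mathbf v$ is injective on $\{(\mathbf m,\mathbf v):\mathbf m\in\mathcal M,\ \mathbf v\in N_{\mathbf m}\mathcal M,\ \|\mathbf v\|_2<\tau\}$, where $N_{\mathbf m}\mathcal M$ is the normal space at $\mathbf m$. The projection operator $P_{\mathcal M}\colon U\to\mathcal M$, $P_{\mathcal M}(\mathbf x)=\operatorname{argmin}_{\mathbf m\in\mathcal M}\|\mathbf x-\mathbf m\|_2$, is well defined on $U=\{\mathbf y\in\mathbb R^d:\min_{\mathbf m\in\mathcal M}\|\mathbf y-\mathbf m\|_2<\tau\}$. An approximation operator here is just any map $C(\Omega,\mathbb R^d)\to C(\Omega,\mathbb R^d)$, and $f\in C(\Omega,\mathcal M)$ is regarded as an element of $C(\Omega,\mathbb R^d)$ through $\mathcal M\subset\mathbb R^d$. *)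

theory Defs
  imports "HOL-Analysis.Analysis"
begin

text \<open>
  \<open>k\<close>-times continuously differentiable functions and smooth functions. Derivatives are
  two-sided (\<^term>\<open>at x\<close>), so these notions are only meant for open \<open>S\<close>.
\<close>

primrec k_smooth_on ::
    "nat \<Rightarrow> ('a::euclidean_space \<Rightarrow> 'b::real_normed_vector) \<Rightarrow> 'a set \<Rightarrow> bool" where
  "k_smooth_on 0 f S \<longleftrightarrow> continuous_on S f"
| "k_smooth_on (Suc k) f S \<longleftrightarrow>
     (\<forall>x\<in>S. f differentiable (at x)) \<and>
     (\<forall>v. k_smooth_on k (\<lambda>x. frechet_derivative f (at x) v) S)"

definition smooth_on :: "('a::euclidean_space \<Rightarrow> 'b::real_normed_vector) \<Rightarrow> 'a set \<Rightarrow> bool" where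
  "smooth_on f S \<longleftrightarrow> (\<forall>k. k_smooth_on k f S)"

text \<open>
  Embedded \<open>k\<close>-dimensional submanifolds without boundary: near each of its points, \<open>M\<close> is
  mapped onto an open piece of a \<open>k\<close>-dimensional linear subspace by a diffeomorphism \<open>\<phi>\<close>
  (with inverse \<open>\<psi>\<close>) between open subsets of the ambient space.
\<close>

definition smooth_submanifold :: "nat \<Rightarrow> (real ^ 'd) set \<Rightarrow> bool" where
  "smooth_submanifold k M \<longleftrightarrow>
     (\<forall>p\<in>M. \<exists>V W L (\<phi> :: real ^ 'd \<Rightarrow> real ^ 'd) (\<psi> :: real ^ 'd \<Rightarrow> real ^ 'd).
        open V \<and> p \<in> V \<and> open W \<and> homeomorphism V W \<phi> \<psi> \<and>
        smooth_on \<phi> V \<and> smooth_on \<psi> W \<and>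
        subspace L \<and> dim L = k \<and> \<phi> ` (V \<inter> M) = W \<inter> L)"

definition tangent_space_at :: "(real ^ 'd) set \<Rightarrow> real ^ 'd \<Rightarrow> (real ^ 'd) set" where
  "tangent_space_at M m =
     {v. \<exists>\<gamma> e. 0 < e \<and> smooth_on \<gamma> {-e<..<e} \<and> \<gamma> ` {-e<..<e} \<subseteq> M \<and>
           \<gamma> 0 = m \<and> (\<gamma> has_vector_derivative v) (at (0::real))}"

definition normal_space_at :: "(real ^ 'd) set \<Rightarrow> real ^ 'd \<Rightarrow> (real ^ 'd) set" where
  "normal_space_at M m = orthogonal_comp (tangent_space_at M m)"

definition normal_tube :: "(real ^ 'd) set \<Rightarrow> ereal \<Rightarrow> ((real ^ 'd) \<times> (real ^ 'd)) set" where
  "normal_tube M \<tau> = {(m, v). m \<in> M \<and> v \<in> normal_space_at M m \<and> ereal (norm v) < \<tau>}"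

text \<open>
  The reach is extended-real-valued because it is infinite for, e.g., a single point. The
  supremum is attained, so it is the maximal admissible constant; see \<open>reach_maximal\<close>.
\<close>

definition reach :: "(real ^ 'd) set \<Rightarrow> ereal" where
  "reach M = Sup {\<tau>. inj_on (\<lambda>(m, v). m + v) (normal_tube M \<tau>)}"

lemma reach_maximal:
  "inj_on (\<lambda>(m, v). m + v) (normal_tube M \<tau>) \<longleftrightarrow> \<tau> \<le> reach M"
proof
  assume "inj_on (\<lambda>(m, v). m + v) (normal_tube M \<tau>)"
  then show "\<tau> \<le> reach M" unfolding reach_def by (auto intro: Sup_upper)
next
  assume le: "\<tau> \<le> reach M"
  show "inj_on (\<lambda>(m, v). m + v) (normal_tube M \<tau>)"
  proof (rule inj_onI)
    fix p q assume p: "p \<in> normal_tube M \<tau>" and q: "q \<in> normal_tube M \<tau>"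
      and eq: "(\<lambda>(m, v). m + v) p = (\<lambda>(m, v). m + v) q"
    have "max (ereal (norm (snd p))) (ereal (norm (snd q))) < reach M"
      using p q le unfolding normal_tube_def by auto
    then obtain s where inj: "inj_on (\<lambda>(m, v). m + v) (normal_tube M s)"
      and s: "max (ereal (norm (snd p))) (ereal (norm (snd q))) < s"
      unfolding reach_def less_Sup_iff by auto
    have "p \<in> normal_tube M s" "q \<in> normal_tube M s"
      using p q s unfolding normal_tube_def by auto
    with inj eq show "p = q" by (meson inj_onD)
  qed
qed

definition reach_nbhd :: "(real ^ 'd) set \<Rightarrow> (real ^ 'd) set" where
  "reach_nbhd M = {y. ereal (infdist y M) < reach M}"

text \<open>The unique nearest point; unspecified where there is none or more than one.\<close>

definition nearest_point_proj :: "(real ^ 'd) set \<Rightarrow> real ^ 'd \<Rightarrow> real ^ 'd" where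
  "nearest_point_proj M x = (THE m. is_arg_min (\<lambda>m. norm (x - m)) (\<lambda>m. m \<in> M) m)"

text \<open>
  \<open>C(\<Omega>, S)\<close>. Functions are taken extensional so that two of them are equal as soon as they
  agree on \<open>\<Omega>\<close>; in particular \<open>C(\<Omega>, M) \<subseteq> C(\<Omega>, \<real>\<^sup>d)\<close> literally.
\<close>

definition cont_maps :: "'w topology \<Rightarrow> (real ^ 'd) set \<Rightarrow> ('w \<Rightarrow> real ^ 'd) set" where
  "cont_maps \<Omega> S = {f \<in> extensional (topspace \<Omega>). continuous_map \<Omega> (top_of_set S) f}"

end

theory Submission
  imports Defs
begin

text \<open>
  By Fermat's criterion along curves in \<open>M\<close>, \<open>x - m\<close> is normal to \<open>M\<close> at every nearest point
  \<open>m\<close> of \<open>x\<close>. Inside the reach, injectivity of \<open>(m, v) \<mapsto> m + v\<close> hence makes the nearest point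
  unique, so the projection is a genuine minimiser, and the bound is the triangle inequality
  \<open>\<parallel>P x - y\<parallel> \<le> \<parallel>P x - x\<parallel> + \<parallel>x - y\<parallel> \<le> 2 \<parallel>x - y\<parallel>\<close> for \<open>y \<in> M\<close>.
\<close>

lemma nearest_point_diff_in_normal_space:
  fixes M :: "(real ^ 'd) set"
  assumes min: "is_arg_min (\<lambda>m. norm (x - m)) (\<lambda>m. m \<in> M) m"
  shows "x - m \<in> normal_space_at M m"
proof -
  have "v \<bullet> (x - m) = 0" if v: "v \<in> tangent_space_at M m" for v
  proof -
    obtain \<gamma> :: "real \<Rightarrow> real ^ 'd" and e where e: "0 < e" and sub: "\<gamma> ` {-e<..<e} \<subseteq> M"
      and \<gamma>0: "\<gamma> 0 = m" and deriv: "(\<gamma> has_vector_derivative v) (at 0)"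
      using v unfolding tangent_space_at_def by blast
    \<comment> \<open>The squared distance is differentiable even if \<open>x = m\<close>, where the
      norm is not.\<close>
    have "((\<lambda>t. (x - \<gamma> t) \<bullet> (x - \<gamma> t)) has_derivative
        (\<lambda>h. (x - \<gamma> 0) \<bullet> (0 - h *\<^sub>R v) + (0 - h *\<^sub>R v) \<bullet> (x - \<gamma> 0))) (at 0)"
      using deriv unfolding has_vector_derivative_def by (intro derivative_intros)
    then have "((\<lambda>t. (x - \<gamma> t) \<bullet> (x - \<gamma> t)) has_real_derivative - 2 * (v \<bullet> (x - m))) (at 0)"
      unfolding has_field_derivative_def
      by (rule has_derivative_eq_rhs) (auto simp: \<gamma>0 inner_commute algebra_simps)
    \<comment> \<open>The minimum is only local in \<open>t\<close>, since the curve is known to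
      stay in \<open>M\<close> only for parameters in \<open>{-e<..<e}\<close>.\<close>
    moreover have "(x - \<gamma> 0) \<bullet> (x - \<gamma> 0) \<le> (x - \<gamma> t) \<bullet> (x - \<gamma> t)" if "\<bar>0 - t\<bar> < e" for t
    proof -
      have "\<gamma> t \<in> M" using that by (intro subsetD[OF sub] imageI) auto
      then have "norm (x - m) \<le> norm (x - \<gamma> t)"
        using min unfolding is_arg_min_linorder by auto
      then show ?thesis by (simp add: \<gamma>0 norm_le)
    qed
    ultimately have "- 2 * (v \<bullet> (x - m)) = 0"
      using e by (intro DERIV_local_min) auto
    then show ?thesis by simp
  qed
  then show ?thesis
    unfolding normal_space_at_def orthogonal_comp_def orthogonal_def by blast
qed

text \<open>Turns the bound on \<open>infdist\<close> that defines \<open>reach_nbhd\<close> into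
  the bound on the normal vector \<open>x - m\<close> that \<open>normal_tube\<close> asks for. The
  default \<open>infdist x {} = 0\<close> cannot interfere, as \<open>m\<close> lies in
  \<open>M\<close>.\<close>

lemma is_arg_min_norm_imp_infdist:
  assumes "is_arg_min (\<lambda>m. norm (x - m)) (\<lambda>m. m \<in> M) m"
  shows "norm (x - m) = infdist x M"
proof (rule antisym)
  have m: "m \<in> M" and le: "\<And>y. y \<in> M \<Longrightarrow> dist x m \<le> dist x y"
    using assms unfolding is_arg_min_linorder dist_norm by auto
  then show "norm (x - m) \<le> infdist x M"
    unfolding dist_norm[symmetric] infdist_def by (auto intro!: cINF_greatest)
  show "infdist x M \<le> norm (x - m)"
    using infdist_le[OF m] by (simp add: dist_norm)
qed

lemma nearest_point_unique:
  assumes x: "x \<in> reach_nbhd M"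
    and m: "is_arg_min (\<lambda>m. norm (x - m)) (\<lambda>m. m \<in> M) m"
    and n: "is_arg_min (\<lambda>m. norm (x - m)) (\<lambda>m. m \<in> M) n"
  shows "m = n"
proof -
  have tube: "(p, x - p) \<in> normal_tube M (reach M)"
    if "is_arg_min (\<lambda>m. norm (x - m)) (\<lambda>m. m \<in> M) p" for p
    using x that nearest_point_diff_in_normal_space[OF that] is_arg_min_norm_imp_infdist[OF that]
    unfolding normal_tube_def reach_nbhd_def is_arg_min_def by auto
  \<comment> \<open>The supremum is attained, so the radius \<open>reach M\<close> itself is
    admissible; both \<open>(m, x - m)\<close> and \<open>(n, x - n)\<close> are sent to
    \<open>x\<close>.\<close>
  have "inj_on (\<lambda>(m, v). m + v) (normal_tube M (reach M))"
    by (simp add: reach_maximal)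
  from inj_onD[OF this _ tube[OF m] tube[OF n]] show ?thesis by simp
qed

text \<open>Closedness gives existence and the reach gives uniqueness, so the description by
  \<open>THE\<close> denotes.\<close>

lemma nearest_point_proj_is_arg_min:
  assumes "closed M" "M \<noteq> {}" "x \<in> reach_nbhd M"
  shows "is_arg_min (\<lambda>m. norm (x - m)) (\<lambda>m. m \<in> M) (nearest_point_proj M x)"
proof -
  obtain m where "m \<in> M" "\<And>y. y \<in> M \<Longrightarrow> dist x m \<le> dist x y"
    using distance_attains_inf[OF assms(1,2)] by blast
  then have m: "is_arg_min (\<lambda>m. norm (x - m)) (\<lambda>m. m \<in> M) m"
    unfolding is_arg_min_linorder dist_norm by auto
  show ?thesis
    unfolding nearest_point_proj_def
    by (rule theI, rule m, rule nearest_point_unique[OF assms(3) _ m])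
qed

lemma norm_nearest_point_proj_diff_le:
  assumes "closed M" "x \<in> reach_nbhd M" "y \<in> M"
  shows "norm (nearest_point_proj M x - y) \<le> 2 * norm (x - y)"
proof -
  \<comment> \<open>Here \<open>y\<close> serves twice: it shows \<open>M \<noteq> {}\<close> and it
    competes with the minimiser.\<close>
  have "norm (x - nearest_point_proj M x) \<le> norm (x - y)"
    using nearest_point_proj_is_arg_min[of M x] assms unfolding is_arg_min_linorder by blast
  then show ?thesis
    using norm_triangle_ineq[of "nearest_point_proj M x - x" "x - y"]
    by (simp add: norm_minus_commute)
qed

theorem theorem3p1:
  fixes M :: "(real ^ 'd) set" and k :: nat and \<Omega> :: "'w topology"
    and I :: "('w \<Rightarrow> real ^ 'd) \<Rightarrow> ('w \<Rightarrow> real ^ 'd)" and f :: "'w \<Rightarrow> real ^ 'd"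
  assumes "smooth_submanifold k M" and "compact M"
    and "I \<in> cont_maps \<Omega> UNIV \<rightarrow> cont_maps \<Omega> UNIV"
    and "f \<in> cont_maps \<Omega> M"
    and "\<forall>x\<in>topspace \<Omega>. I f x \<in> reach_nbhd M"
  shows "\<forall>x\<in>topspace \<Omega>. norm ((nearest_point_proj M \<circ> I f) x - f x) \<le> 2 * norm (I f x - f x)"
proof
  fix x assume x: "x \<in> topspace \<Omega>"
  then have "f x \<in> M"
    using assms(4) unfolding cont_maps_def continuous_map_def by auto
  with x assms(2,5) show "norm ((nearest_point_proj M \<circ> I f) x - f x) \<le> 2 * norm (I f x - f x)"
    by (simp add: norm_nearest_point_proj_diff_le compact_imp_closed)
qed

end
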